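(* Let $\mathcal{K}$ be a differential field with derivation $\partial$, and let $R \subseteq \mathcal{K}$ be a differential subring (a subring closed under the derivation). Let $n\ge 1$ and let $M$ be an $n\times n$ matrix whose entries lie in $R[\partial]$, viewed as a matrix over the ring $\mathcal{K}[\partial]$ of differential operators. Let $\det M = D\lambda^{d}$ be its Dieudonné determinant, where $D = \det_1 M \in \mathcal{K}$ and $d = d(M)$. If the degeneracy degree of $M$ is $dd(M) = 1$, then $D \in R$.
   Context: A differential field $\mathcal{K}$ is a (commutative) field with a derivation $\partial$. $\mathcal{K}[\partial]$ is the (noncommutative) ring of differential operators $\sum_{k=0}^m a_k\partial^k$ with $a_k\in\mathcal{K}$ and multiplication determined by $\partial\cdot a = a\,\partial + \partial(a)$ for $a\in\mathcal{K}$. For a differential subring $R$, $R[\partial]$ denotes the set of operators $\sum_k a_k \partial^k$ with all $a_k\in R$. For a nonzero operator $P=\sum_{k=0}^m a_k\partial^k$ with $a_m\neq 0$, the order is $\mathrm{ord}(P)=m$ and the leading coefficient is $a_m$; $\mathrm{ord}(0)=-\infty$. Dieudonné determinant: for an $n\times n$ matrix $A$ over $\mathcal{K}[\partial]$, it has the form $\det A = \det_1 A\,\lambda^{d(A)}$, where $\det_1 A\in\mathcal{K}$, $\lambda$ is an indeterminate, and $d(A)$ is an integer (the order of $\det A$), or $-\infty$ when $\det_1 A=0$. It is characterized by the following properties: (1) $\det(AB)=\det A\cdot\det B$, i.e. $\det_1(AB)=\det_1 A\,\det_1 B$ and $d(AB)=d(A)+d(B)$; (2) interchanging two rows of $A$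 changes the sign of $\det A$; (3) subtracting $h$ times (left multiplication) the $i$-th row from the $j$-th row, with $h\in\mathcal{K}[\partial]$ and $i\ne j$, leaves $\det A$ unchanged; (4) if $A$ is upper triangular, then $\det_1 A$ is the product of the leading coefficients of the diagonal entries and $d(A)$ is the sum of their orders, with $\det_1 A=0$ and $d(A)=-\infty$ if some diagonal entry is $0$. (The existence of such a determinant is due to Dieudonné.) Total order: $\mathrm{tord}(A)=\max_{\sigma\in S_n}\sum_{i=1}^n \mathrm{ord}(A_{i,\sigma(i)})$, where $S_n$ is the group of permutations of $\{1,\dots,n\}$. Degeneracy degree: $dd(A)=\mathrm{tord}(A)-d(A)$. (In particular, $dd(A)=1$ means that $\mathrm{tord}(A)$ and $d(A)$ are finite, so $\det A\ne 0$, and $\mathrm{tord}(A)=d(A)+1$.) *)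

theory Defs
  imports
    "HOL-Computational_Algebra.Polynomial"
    "HOL-Library.Extended"
    "HOL-Combinatorics.Permutations"
    "Jordan_Normal_Form.Gauss_Jordan_Elimination"
begin

hide_const (open) module.smult

section \<open>Differential fields and differential subrings\<close>

class differential_field = field +
  fixes derivation :: "'a \<Rightarrow> 'a"
  assumes derivation_add: "derivation (a + b) = derivation a + derivation b"
    and derivation_mult: "derivation (a * b) = derivation a * b + a * derivation b"
begin

lemma derivation_0 [simp]: "derivation 0 = 0"
  using derivation_add[of 0 0] by simp

lemma derivation_1 [simp]: "derivation 1 = 0"
  using derivation_mult[of 1 1] by simp

end

text \<open>Subrings are unital.\<close>

definition differential_subring :: "'a::differential_field set \<Rightarrow> bool" where
  "differential_subring R \<longleftrightarrow>
     1 \<in> R \<and> (\<forall>a\<in>R. \<forall>b\<in>R. a - b \<in> R \<and> a * b \<in> R) \<and> (\<forall>a\<in>R. derivation a \<in> R)"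


section \<open>The ring of differential operators\<close>

text \<open>
  The operator $\sum_k a_k \partial^k$ is stored as the coefficient sequence $(a_k)_k$, in the form
  of a polynomial; only the additive structure of polynomials is inherited.
\<close>

typedef (overloaded) 'a diff_op = "UNIV :: 'a::differential_field poly set"
  morphisms poly_of_diff_op diff_op_of_poly ..

setup_lifting type_definition_diff_op

text \<open>
  Left multiplication by $\partial$:
  $\partial \sum_k b_k \partial^k = \sum_k b_k \partial^{k+1} + \sum_k \partial(b_k) \partial^k$.
\<close>

definition del_times :: "'a::differential_field poly \<Rightarrow> 'a poly" where
  "del_times q = pCons 0 q + map_poly derivation q"

text \<open>$(\sum_k a_k \partial^k) Q = \sum_k a_k (\partial^k Q)$.\<close>

definition op_times :: "'a::differential_field poly \<Rightarrow> 'a poly \<Rightarrow> 'a poly" where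
  "op_times p q = (\<Sum>k\<le>degree p. smult (coeff p k) ((del_times ^^ k) q))"

lemma op_times_bound:
  assumes "degree p \<le> N"
  shows "op_times p q = (\<Sum>k\<le>N. smult (coeff p k) ((del_times ^^ k) q))"
  unfolding op_times_def
  by (rule sum.mono_neutral_left) (use assms in \<open>auto simp: coeff_eq_0\<close>)

lemma map_poly_derivation_add:
  "map_poly derivation (p + q) = map_poly derivation p + map_poly derivation q"
  by (rule poly_eqI) (simp add: coeff_map_poly derivation_add)

lemma del_times_add: "del_times (p + q) = del_times p + del_times q"
  by (simp add: del_times_def map_poly_derivation_add)

lemma del_times_0 [simp]: "del_times 0 = 0"
  by (simp add: del_times_def)

lemma del_times_smult:
  "del_times (smult a q) = smult a (del_times q) + smult (derivation a) q"
proof -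
  have "map_poly derivation (smult a q) = smult a (map_poly derivation q) + smult (derivation a) q"
    by (rule poly_eqI) (simp add: coeff_map_poly derivation_mult)
  then show ?thesis by (simp add: del_times_def smult_add_right)
qed

lemma del_times_sum: "del_times (sum f A) = (\<Sum>x\<in>A. del_times (f x))"
  by (induction A rule: infinite_finite_induct) (simp_all add: del_times_add)

lemma del_times_pow_add: "(del_times ^^ k) (p + q) = (del_times ^^ k) p + (del_times ^^ k) q"
  by (induction k) (simp_all add: del_times_add)

lemma op_times_add_right: "op_times p (q + r) = op_times p q + op_times p r"
  by (simp add: op_times_def del_times_pow_add smult_add_right sum.distrib)

lemma op_times_add_left: "op_times (p + q) r = op_times p r + op_times q r"
proof -
  let ?N = "max (degree p) (degree q)"
  have "degree (p + q) \<le> ?N" by (rule degree_add_le_max)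
  then show ?thesis
    by (simp add: op_times_bound[of _ ?N] smult_add_left sum.distrib)
qed

lemma op_times_0_left [simp]: "op_times 0 q = 0"
  by (simp add: op_times_def)

lemma smult_sum_distrib: "smult a (sum f A) = (\<Sum>x\<in>A. smult a (f x))"
  by (induction A rule: infinite_finite_induct) (simp_all add: smult_add_right)

lemma op_times_smult_left: "op_times (smult a p) q = smult a (op_times p q)"
  by (simp add: op_times_bound[of _ "degree p"] degree_smult_le smult_sum_distrib)

lemma op_times_sum_left: "op_times (sum f A) q = (\<Sum>x\<in>A. op_times (f x) q)"
  by (induction A rule: infinite_finite_induct) (simp_all add: op_times_add_left)

lemma op_times_pCons_0: "op_times (pCons 0 p) q
    = (\<Sum>k\<le>degree p. smult (coeff p k) ((del_times ^^ Suc k) q))"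
proof -
  have "degree (pCons 0 p) \<le> Suc (degree p)" by (rule degree_pCons_le)
  then show ?thesis
    by (simp add: op_times_bound sum.atMost_Suc_shift del: sum.atMost_Suc funpow.simps)
qed

lemma op_times_del_times: "op_times (del_times p) q = del_times (op_times p q)"
proof -
  have "degree (map_poly derivation p) \<le> degree p"
    by (rule map_poly_degree_leq)
  then show ?thesis
    by (simp add: del_times_def[of p] op_times_add_left op_times_pCons_0
        op_times_bound[of _ "degree p"] coeff_map_poly del_times_sum del_times_smult sum.distrib)
qed

lemma op_times_del_times_pow: "op_times ((del_times ^^ k) p) q = (del_times ^^ k) (op_times p q)"
  by (induction k) (simp_all add: op_times_del_times)

lemma op_times_assoc: "op_times (op_times p q) r = op_times p (op_times q r)"
  by (simp add: op_times_def[of p] op_times_sum_left op_times_smult_left op_times_del_times_pow)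

lemma op_times_1_left: "op_times 1 q = q"
  by (simp add: op_times_def)

lemma del_times_pow_1: "(del_times ^^ k) 1 = monom 1 k"
proof (induction k)
  case (Suc k)
  have "map_poly derivation (monom 1 k) = (0 :: 'a poly)"
    by (rule poly_eqI) (simp add: coeff_map_poly)
  then have "del_times (monom 1 k) = (monom 1 (Suc k) :: 'a poly)"
    by (simp add: del_times_def monom_Suc)
  then show ?case by (simp add: Suc)
qed simp

lemma op_times_1_right: "op_times p 1 = p"
  by (simp add: op_times_def del_times_pow_1 smult_monom poly_as_sum_of_monoms)

instantiation diff_op :: (differential_field) ring_1
begin

lift_definition zero_diff_op :: "'a diff_op" is 0 .
lift_definition one_diff_op :: "'a diff_op" is 1 .
lift_definition plus_diff_op :: "'a diff_op \<Rightarrow> 'a diff_op \<Rightarrow> 'a diff_op" is "(+)" .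
lift_definition minus_diff_op :: "'a diff_op \<Rightarrow> 'a diff_op \<Rightarrow> 'a diff_op" is "(-)" .
lift_definition uminus_diff_op :: "'a diff_op \<Rightarrow> 'a diff_op" is uminus .
lift_definition times_diff_op :: "'a diff_op \<Rightarrow> 'a diff_op \<Rightarrow> 'a diff_op" is op_times .

instance
  by (standard; transfer)
    (simp_all add: op_times_assoc op_times_1_left op_times_1_right op_times_add_left
      op_times_add_right)

end

lift_definition op_const :: "'a::differential_field \<Rightarrow> 'a diff_op" is "\<lambda>a. [:a:]" .
lift_definition op_del :: "'a::differential_field diff_op" is "[:0, 1:]" .
lift_definition op_coeff :: "'a::differential_field diff_op \<Rightarrow> nat \<Rightarrow> 'a" is coeff .
lift_definition op_lead_coeff :: "'a::differential_field diff_op \<Rightarrow> 'a" is lead_coeff .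
lift_definition op_order :: "'a::differential_field diff_op \<Rightarrow> int extended" is
  "\<lambda>p. if p = 0 then -\<infinity> else Fin (int (degree p))" .

lemma op_const_mult: "op_const a * op_const b = op_const (a * b)"
  by transfer (simp add: op_times_def)

lemma op_del_mult_const: "op_del * op_const a = op_const a * op_del + op_const (derivation a)"
  by transfer (simp add: op_times_def del_times_def map_poly_pCons)

lemma op_del_power: "op_del ^ k = diff_op_of_poly (monom 1 k)"
proof (induction k)
  case 0
  then show ?case by (simp add: one_diff_op_def)
next
  case (Suc k)
  have "map_poly derivation (monom 1 k) = (0 :: 'a poly)"
    by (rule poly_eqI) (simp add: coeff_map_poly)
  then have "op_times [:0, 1:] (monom 1 k) = (monom 1 (Suc k) :: 'a poly)"
    by (simp add: op_times_def del_times_def monom_Suc)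
  then show ?case
    unfolding power_Suc Suc unfolding op_del_def by (simp add: times_diff_op.abs_eq)
qed

lemma diff_op_expansion:
  assumes "\<And>k. k > N \<Longrightarrow> op_coeff P k = 0"
  shows "P = (\<Sum>k\<le>N. op_const (op_coeff P k) * op_del ^ k)"
proof -
  have sum_rep: "poly_of_diff_op (sum f A) = (\<Sum>x\<in>A. poly_of_diff_op (f x))"
    for f :: "nat \<Rightarrow> 'a diff_op" and A
    by (induction A rule: infinite_finite_induct) (simp_all add: zero_diff_op.rep_eq plus_diff_op.rep_eq)
  have "poly_of_diff_op (op_const a * op_del ^ k) = monom a k" for a :: 'a and k
    by (simp add: op_del_power times_diff_op.rep_eq op_const.rep_eq diff_op_of_poly_inverse
        op_times_def smult_monom)
  moreover have "degree (poly_of_diff_op P) \<le> N"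
    using assms by (intro degree_le) (simp add: op_coeff.rep_eq)
  ultimately show ?thesis
    by (simp add: poly_of_diff_op_inject[symmetric] sum_rep op_coeff.rep_eq poly_as_sum_of_monoms')
qed

definition diff_ops_over :: "'a::differential_field set \<Rightarrow> 'a diff_op set" where
  "diff_ops_over R = {P. \<forall>k. op_coeff P k \<in> R}"


section \<open>Dieudonne determinant, total order and degeneracy degree\<close>

text \<open>
  A pair \<open>det1\<close>, \<open>det_deg\<close> is the Dieudonne determinant
  $A \mapsto \mathrm{det}_1(A)\,\lambda^{d(A)}$ on $n \times n$ matrices if it has the
  characterizing properties below. Rows are indexed from 0. In the triangular case a zero diagonal
  entry has leading coefficient 0 and order \<open>-\<infinity>\<close>, which is absorbing for addition of
  values other than \<open>\<infinity>\<close>, so the formulas yield 0 and \<open>-\<infinity>\<close>.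
\<close>

locale dieudonne_det =
  fixes n :: nat
    and det1 :: "'a::differential_field diff_op mat \<Rightarrow> 'a"
    and det_deg :: "'a diff_op mat \<Rightarrow> int extended"
  assumes det_deg_not_infinity:
      "A \<in> carrier_mat n n \<Longrightarrow> det_deg A \<noteq> \<infinity>"
    and det_deg_eq_minus_infinity_iff:
      "A \<in> carrier_mat n n \<Longrightarrow> det_deg A = -\<infinity> \<longleftrightarrow> det1 A = 0"
    and det1_mult:
      "A \<in> carrier_mat n n \<Longrightarrow> B \<in> carrier_mat n n \<Longrightarrow> det1 (A * B) = det1 A * det1 B"
    and det_deg_mult:
      "A \<in> carrier_mat n n \<Longrightarrow> B \<in> carrier_mat n n \<Longrightarrow> det_deg (A * B) = det_deg A + det_deg B"
    and det1_swaprows: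
      "A \<in> carrier_mat n n \<Longrightarrow> i < n \<Longrightarrow> j < n \<Longrightarrow> i \<noteq> j \<Longrightarrow> det1 (swaprows i j A) = - det1 A"
    and det_deg_swaprows:
      "A \<in> carrier_mat n n \<Longrightarrow> i < n \<Longrightarrow> j < n \<Longrightarrow> i \<noteq> j \<Longrightarrow> det_deg (swaprows i j A) = det_deg A"
    \<comment> \<open>\<open>addrow (- h) j i A\<close> subtracts the left multiple by \<open>h\<close> of row \<open>i\<close> from row \<open>j\<close>\<close>
    and det1_addrow:
      "A \<in> carrier_mat n n \<Longrightarrow> i < n \<Longrightarrow> j < n \<Longrightarrow> i \<noteq> j \<Longrightarrow> det1 (addrow (- h) j i A) = det1 A"
    and det_deg_addrow:
      "A \<in> carrier_mat n n \<Longrightarrow> i < n \<Longrightarrow> j < n \<Longrightarrow> i \<noteq> j \<Longrightarrow> det_deg (addrow (- h) j i A) = det_deg A"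
    and det1_upper_triangular:
      "A \<in> carrier_mat n n \<Longrightarrow> upper_triangular A \<Longrightarrow> det1 A = (\<Prod>i<n. op_lead_coeff (A $$ (i, i)))"
    and det_deg_upper_triangular:
      "A \<in> carrier_mat n n \<Longrightarrow> upper_triangular A \<Longrightarrow> det_deg A = (\<Sum>i<n. op_order (A $$ (i, i)))"

definition total_order :: "'a::differential_field diff_op mat \<Rightarrow> int extended" where
  "total_order A =
     Max ((\<lambda>\<sigma>. \<Sum>i<dim_row A. op_order (A $$ (i, \<sigma> i))) ` {\<sigma>. \<sigma> permutes {..<dim_row A}})"

text \<open>
  The first argument is the degree \<open>d\<close> of the Dieudonne determinant. For singular \<open>A\<close>
  (\<open>d A = -\<infinity>\<close>) the difference is \<open>\<infinity>\<close> in \<^typ>\<open>int extended\<close>, also when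
  \<open>total_order A = -\<infinity>\<close>.
\<close>

definition degeneracy_degree ::
    "('a::differential_field diff_op mat \<Rightarrow> int extended) \<Rightarrow> 'a diff_op mat \<Rightarrow> int extended" where
  "degeneracy_degree d A = total_order A - d A"

end

theory Submission
  imports
    Defs
    "HOL-Combinatorics.Cycles"
    "Jordan_Normal_Form.Determinant"
begin

hide_const (open) module.smult

text \<open>
  By Egervary's duality for the assignment problem the total order is \<open>\<Sum> N\<^sub>j + \<Sum> g\<^sub>i\<close> for integers bounding
  the orders of all entries by \<open>N\<^sub>j + g\<^sub>i\<close>, and after multiplying the rows by powers of the
  derivation, \<open>g = 0\<close>. Let \<open>a\<close> and \<open>b\<close> be the matrices of coefficients at
  \<open>\<partial>\<close> to the powers \<open>N\<^sub>j\<close> and \<open>N\<^sub>j - 1\<close>. Whatever the bounds, the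
  coefficient of the Dieudonne determinant at the sum of the bounds is the commutative determinant of
  the matrix of top coefficients: this persists under triangularisation by Ore operations. Degeneracy 1
  therefore forces \<open>det a = 0\<close>. Take \<open>u a = 0\<close> with \<open>u\<^sub>i = 1\<close> and replace row \<open>i\<close> by
  \<open>\<partial>\<close> times the combination of the rows with coefficients \<open>u\<close>. The new matrix is nondegenerate with
  the same \<open>det\<^sub>1\<close>, so \<open>det\<^sub>1 M\<close> is the determinant of \<open>a\<close> with row \<open>i\<close> replaced by \<open>u b\<close>.
  That is the coefficient of \<open>X\<close> in \<open>det (a + b X)\<close>, a polynomial expression in the entries of
  \<open>a\<close> and \<open>b\<close>, in which \<open>u\<close> no longer occurs.
\<close>

section \<open>Orders and the Ore condition\<close>

lemma degree_del_times_le: "degree (del_times q) \<le> Suc (degree q)"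
  unfolding del_times_def
  by (intro degree_add_le order.trans[OF map_poly_degree_leq] degree_pCons_le) auto

lemma coeff_del_times:
  "coeff (del_times q) k = (case k of 0 \<Rightarrow> 0 | Suc m \<Rightarrow> coeff q m) + derivation (coeff q k)"
  by (simp add: del_times_def coeff_map_poly coeff_pCons)

text \<open>The derivation never raises the degree, so at the top only the shift by
  \<open>pCons 0\<close> acts. A bound \<open>N\<close> in place of the degree admits vanishing top
  coefficients.\<close>

lemma del_times_pow_leading:
  assumes "degree q \<le> N"
  shows "degree ((del_times ^^ k) q) \<le> N + k \<and> coeff ((del_times ^^ k) q) (N + k) = coeff q N"
proof (induction k)
  case (Suc k)
  then have "degree ((del_times ^^ Suc k) q) \<le> N + Suc k"
    using degree_del_times_le[of "(del_times ^^ k) q"] by simp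
  moreover have "coeff ((del_times ^^ k) q) (Suc (N + k)) = 0"
    using Suc by (intro coeff_eq_0) simp
  ultimately show ?case
    using Suc by (simp add: coeff_del_times)
qed (use assms in simp)

text \<open>Moving the derivation past a coefficient only creates terms of lower order, so at the
  sum of the bounds the product is that of commutative polynomials.\<close>

lemma op_times_leading:
  assumes p: "degree p \<le> m" and q: "degree q \<le> n"
  shows "degree (op_times p q) \<le> m + n" (is ?A)
    and "coeff (op_times p q) (m + n) = coeff p m * coeff q n" (is ?B)
proof -
  note lead = del_times_pow_leading[OF q]
  show ?A
    unfolding op_times_bound[OF p]
  proof (intro degree_sum_le)
    fix k assume "k \<in> {..m}"
    then show "degree (smult (coeff p k) ((del_times ^^ k) q)) \<le> m + n"
      using lead[of k] degree_smult_le[of "coeff p k" "(del_times ^^ k) q"] by simp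
  qed simp
  have "coeff ((del_times ^^ k) q) (m + n) = 0" if "k < m" for k
    using lead[of k] that by (intro coeff_eq_0) simp
  then have "coeff (op_times p q) (m + n)
      = (\<Sum>k\<in>{m}. coeff p k * coeff ((del_times ^^ k) q) (m + n))"
    unfolding op_times_bound[OF p] coeff_sum coeff_smult
    by (intro sum.mono_neutral_right) auto
  then show ?B
    using lead[of m] by (simp add: add.commute)
qed

text \<open>Unlike \<open>op_order\<close> this is a natural number, 0 for the zero operator, so
  zero entries meet every natural bound.\<close>

lift_definition op_degree :: "'a::differential_field diff_op \<Rightarrow> nat" is degree .

lemma op_degree_0 [simp]: "op_degree 0 = 0"
  by transfer simp

lemma op_coeff_0 [simp]: "op_coeff 0 k = 0"
  by transfer simp

lemma op_coeff_1: "op_coeff 1 k = (if k = 0 then 1 else 0)"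
  by transfer (simp add: coeff_1)

lemma op_degree_1 [simp]: "op_degree 1 = 0"
  by transfer simp

lemma op_coeff_add: "op_coeff (P + Q) k = op_coeff P k + op_coeff Q k"
  by transfer simp

lemma op_coeff_sum: "op_coeff (sum f A) k = (\<Sum>x\<in>A. op_coeff (f x) k)"
  by (induction A rule: infinite_finite_induct) (simp_all add: op_coeff_add)

lemma op_degree_add_le: "op_degree P \<le> m \<Longrightarrow> op_degree Q \<le> m \<Longrightarrow> op_degree (P + Q) \<le> m"
  by transfer (rule degree_add_le)

lemma op_coeff_diff: "op_coeff (P - Q) k = op_coeff P k - op_coeff Q k"
  by transfer simp

lemma op_degree_diff_le: "op_degree P \<le> m \<Longrightarrow> op_degree Q \<le> m \<Longrightarrow> op_degree (P - Q) \<le> m"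
  by transfer (rule degree_diff_le)

lemma op_degree_uminus [simp]: "op_degree (- P) = op_degree P"
  by transfer simp

lemma op_degree_leI: "(\<And>k. k > m \<Longrightarrow> op_coeff P k = 0) \<Longrightarrow> op_degree P \<le> m"
  by transfer (auto intro: degree_le)

lemma op_coeff_eq_0: "op_degree P < k \<Longrightarrow> op_coeff P k = 0"
  by transfer (rule coeff_eq_0)

lemma op_lead_coeff_eq: "op_lead_coeff P = op_coeff P (op_degree P)"
  by transfer simp

lemma op_lead_coeff_eq_0_iff: "op_lead_coeff P = 0 \<longleftrightarrow> P = 0"
  by transfer simp

lemma op_order_eq: "op_order P = (if P = 0 then -\<infinity> else Fin (int (op_degree P)))"
  by transfer simp

lemma op_degree_mult_le: "op_degree P \<le> m \<Longrightarrow> op_degree Q \<le> n \<Longrightarrow> op_degree (P * Q) \<le> m + n"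
  by transfer (rule op_times_leading)

lemma op_coeff_mult_top:
  "op_degree P \<le> m \<Longrightarrow> op_degree Q \<le> n \<Longrightarrow> op_coeff (P * Q) (m + n) = op_coeff P m * op_coeff Q n"
  by transfer (rule op_times_leading)

lemma diff_op_mult_eq_0_iff: "P * Q = 0 \<longleftrightarrow> P = 0 \<or> Q = (0 :: 'a::differential_field diff_op)"
proof
  assume "P * Q = 0"
  then have "op_lead_coeff P * op_lead_coeff Q = 0"
    using op_coeff_mult_top[of P "op_degree P" Q "op_degree Q"] by (simp add: op_lead_coeff_eq)
  then show "P = 0 \<or> Q = 0"
    by (simp add: op_lead_coeff_eq_0_iff)
qed auto

lemma op_degree_mult:
  assumes "P \<noteq> 0" "Q \<noteq> 0"
  shows "op_degree (P * Q) = op_degree P + op_degree Q"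
proof (rule antisym)
  have "op_coeff (P * Q) (op_degree P + op_degree Q) \<noteq> 0"
    using assms by (simp add: op_coeff_mult_top flip: op_lead_coeff_eq op_lead_coeff_eq_0_iff)
  then show "op_degree P + op_degree Q \<le> op_degree (P * Q)"
    using op_coeff_eq_0 leI by blast
qed (simp add: op_degree_mult_le)

lemma op_degree_del [simp]: "op_degree op_del = 1"
  by transfer simp

lemma op_degree_const [simp]: "op_degree (op_const a) = 0"
  by transfer simp

lemma op_coeff_const: "op_coeff (op_const a) k = (if k = 0 then a else 0)"
  by transfer (simp add: coeff_pCons split: nat.split)

lemma op_coeff_del_power: "op_coeff (op_del ^ k) m = (if k = m then 1 else 0)"
  by (simp add: op_del_power op_coeff.abs_eq)

lemma op_degree_del_power [simp]: "op_degree (op_del ^ k) = k"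
  by (simp add: op_del_power op_degree.abs_eq degree_monom_eq)

lemma op_lead_coeff_del_power [simp]: "op_lead_coeff (op_del ^ k) = 1"
  by (simp add: op_lead_coeff_eq op_coeff_del_power)

lemma op_coeff_const_mult: "op_coeff (op_const a * P) k = a * op_coeff P k"
  by transfer (simp add: op_times_def)

lemma op_coeff_del_mult:
  "op_coeff (op_del * P) k = (case k of 0 \<Rightarrow> 0 | Suc m \<Rightarrow> op_coeff P m) + derivation (op_coeff P k)"
  by transfer (simp add: op_times_def coeff_del_times)

section \<open>Right division and common left multiples\<close>

lemma diff_op_division:
  fixes A B :: "'a::differential_field diff_op"
  assumes "A \<noteq> 0"
  shows "\<exists>S T. B = S * A + T \<and> (T = 0 \<or> op_degree T < op_degree A)"
proof (induction "op_degree B" arbitrary: B rule: less_induct)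
  case less
  consider "B = 0" | "op_degree B < op_degree A" | "B \<noteq> 0" "op_degree A \<le> op_degree B" by linarith
  then show ?case
  proof cases
    case 3
    define a where "a = op_lead_coeff A"
    define b where "b = op_lead_coeff B"
    have a: "a \<noteq> 0"
      using assms by (simp add: a_def op_lead_coeff_eq_0_iff)
    define k where "k = op_degree B - op_degree A"
    \<comment> \<open>\<open>H * A\<close> has the leading term of \<open>B\<close>; subtracting it
      lowers the order or leaves 0.\<close>
    define H where "H = op_const (b / a) * op_del ^ k"
    have H: "op_degree H \<le> k" "op_coeff H k = b / a"
      using op_degree_mult_le[of "op_const (b / a)" 0 "op_del ^ k" k]
      by (simp_all add: H_def op_coeff_const_mult op_coeff_del_power)
    have dB: "op_degree B = k + op_degree A"
      using 3 by (simp add: k_def)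
    have deg: "op_degree (B - H * A) \<le> op_degree B"
      using op_degree_mult_le[OF H(1), of A "op_degree A"] dB by (intro op_degree_diff_le) simp_all
    have "op_coeff (B - H * A) (op_degree B) = 0"
      using op_coeff_mult_top[OF H(1), of A "op_degree A"] a
      by (simp add: op_coeff_diff H(2) dB)
        (simp add: a_def b_def op_lead_coeff_eq dB)
    then have "op_degree (B - H * A) = op_degree B \<Longrightarrow> B - H * A = 0"
      by (metis op_lead_coeff_eq op_lead_coeff_eq_0_iff)
    then consider "B - H * A = 0" | "op_degree (B - H * A) < op_degree B"
      using deg by linarith
    then show ?thesis
    proof cases
      case 1
      then have "B = H * A + 0" by (simp add: algebra_simps)
      then show ?thesis by blast
    next
      case 2
      from less[OF this] obtain S T where "B - H * A = S * A + T"
        "T = 0 \<or> op_degree T < op_degree A" by blast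
      moreover from this have "B = (S + H) * A + T" by (simp add: algebra_simps)
      ultimately show ?thesis by blast
    qed
  next
    case 1
    then have "B = 0 * A + 0" by simp
    then show ?thesis by blast
  next
    case 2
    have "B = 0 * A + B" by simp
    then show ?thesis using 2 by blast
  qed
qed

text \<open>Euclid's algorithm: a common left multiple of \<open>A\<close> and the remainder
  \<open>T\<close>, supplied by induction on the order of \<open>A\<close>, yields one of
  \<open>A\<close> and \<open>B\<close>.\<close>

lemma diff_op_ore:
  fixes A B :: "'a::differential_field diff_op"
  assumes "A \<noteq> 0"
  shows "\<exists>P Q. P \<noteq> 0 \<and> P * B = Q * A"
  using assms
proof (induction "op_degree A" arbitrary: A B rule: less_induct)
  case less
  obtain S T where T: "B = S * A + T" "T = 0 \<or> op_degree T < op_degree A"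
    using diff_op_division[OF less.prems] by blast
  show ?case
  proof (cases "T = 0")
    case True
    then have "1 * B = S * A" "(1 :: 'a diff_op) \<noteq> 0" using T by simp_all
    then show ?thesis by blast
  next
    case False
    then obtain P Q where PQ: "P \<noteq> 0" "P * A = Q * T"
      using less.hyps[of T A] T by blast
    then have "Q \<noteq> 0"
      using less.prems by (metis diff_op_mult_eq_0_iff)
    moreover have "Q * B = (Q * S + P) * A"
      by (simp add: T(1) PQ(2) algebra_simps)
    ultimately show ?thesis by blast
  qed
qed

text \<open>The normalisation makes multiplication of a row by \<open>P\<close> preserve
  \<open>det1\<close>.\<close>

lemma diff_op_ore_monic:
  fixes A B :: "'a::differential_field diff_op"
  assumes "A \<noteq> 0"
  obtains P Q where "op_lead_coeff P = 1" "P * B = Q * A"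
proof -
  obtain P Q where PQ: "P \<noteq> 0" "P * B = Q * A"
    using diff_op_ore[OF assms] by blast
  define c where "c = inverse (op_lead_coeff P)"
  have c: "c * op_lead_coeff P = 1"
    using PQ(1) by (simp add: c_def op_lead_coeff_eq_0_iff)
  have "op_const c \<noteq> 0"
    using c op_coeff_const[of c 0] by auto
  then have "op_degree (op_const c * P) = op_degree P"
    using op_degree_mult[of "op_const c" P] PQ(1) by simp
  then have "op_lead_coeff (op_const c * P) = 1"
    using c by (simp add: op_lead_coeff_eq op_coeff_const_mult)
  moreover have "(op_const c * P) * B = (op_const c * Q) * A"
    by (simp add: mult.assoc PQ(2))
  ultimately show ?thesis by (rule that)
qed

section \<open>Operators with coefficients in a differential subring\<close>

lemma differential_subringD:
  assumes "differential_subring R"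
  shows "0 \<in> R" "1 \<in> R" "a \<in> R \<Longrightarrow> b \<in> R \<Longrightarrow> a + b \<in> R" "a \<in> R \<Longrightarrow> - a \<in> R"
    "a \<in> R \<Longrightarrow> b \<in> R \<Longrightarrow> a * b \<in> R" "a \<in> R \<Longrightarrow> derivation a \<in> R"
proof -
  have diff: "x - y \<in> R" if "x \<in> R" "y \<in> R" for x y
    using assms that by (simp add: differential_subring_def)
  show one: "1 \<in> R"
    using assms by (simp add: differential_subring_def)
  show zero: "0 \<in> R"
    using diff[OF one one] by simp
  show uminus: "- a \<in> R" if "a \<in> R" for a
    using diff[OF zero that] by simp
  show "a + b \<in> R" if "a \<in> R" "b \<in> R"
    using diff[OF that(1) uminus[OF that(2)]] by simp
qed (use assms in \<open>simp_all add: differential_subring_def\<close>)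

lemma diff_ops_over_del_power:
  assumes R: "differential_subring R" and P: "P \<in> diff_ops_over R"
  shows "op_del ^ k * P \<in> diff_ops_over R"
proof (induction k)
  case (Suc k)
  then show ?case
    using differential_subringD[OF R]
    by (auto simp: diff_ops_over_def mult.assoc op_coeff_del_mult split: nat.split)
qed (use P in simp)

section \<open>Potentials and the total order\<close>

fun path_weight :: "('a \<Rightarrow> 'a \<Rightarrow> int) \<Rightarrow> 'a list \<Rightarrow> int" where
  "path_weight v (x # y # zs) = v x y + path_weight v (y # zs)"
| "path_weight v _ = 0"

lemma path_weight_append:
  "path_weight v (xs @ y # ys) = path_weight v (xs @ [y]) + path_weight v (y # ys)"
  by (induction v xs rule: path_weight.induct) (auto simp: neq_Nil_conv)

lemma path_weight_conv_map2:
  "path_weight v (x # xs @ [z]) = sum_list (map2 v (x # xs) (xs @ [z]))"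
  by (induction xs arbitrary: x) auto

text \<open>\<open>cycle_of_list\<close> sends each vertex to its successor, which turns the weight
  of a closed walk into a sum over a permutation.\<close>

lemma path_weight_cycle:
  assumes "distinct (x # xs)"
  shows "path_weight v (x # xs @ [x]) = (\<Sum>i\<in>set (x # xs). v i (cycle_of_list (x # xs) i))"
proof -
  let ?c = "cycle_of_list (x # xs)"
  have rot: "map ?c (x # xs) = xs @ [x]"
    using cyclic_rotation[OF assms, of 1] by simp
  have "path_weight v (x # xs @ [x]) = sum_list (map2 v (x # xs) (map ?c (x # xs)))"
    by (simp only: path_weight_conv_map2 rot)
  also have "\<dots> = sum_list (map (\<lambda>i. v i (?c i)) (x # xs))"
    by (simp only: map2_map_map[of v "\<lambda>i. i" _ ?c, simplified])
  also have "\<dots> = (\<Sum>i\<in>set (x # xs). v i (?c i))"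
    using assms by (rule sum_list_distinct_conv_sum_set)
  finally show ?thesis .
qed

lemma successively_cycle:
  assumes "distinct (x # xs)" "successively E (x # xs @ [x])" "i \<in> set (x # xs)"
  shows "E i (cycle_of_list (x # xs) i)"
proof -
  let ?c = "cycle_of_list (x # xs)"
  have rot: "map ?c (x # xs) = xs @ [x]"
    using cyclic_rotation[OF assms(1), of 1] by simp
  have "successively E (y # ys @ [z]) \<Longrightarrow> list_all2 E (y # ys) (ys @ [z])" for y ys z
    by (induction ys arbitrary: y) (auto simp: successively_Cons)
  from this[OF assms(2)] have "list_all2 E (x # xs) (map ?c (x # xs))"
    by (simp only: rot)
  then show ?thesis
    using assms(3) by (auto simp: list_all2_conv_all_nth in_set_conv_nth)
qed

text \<open>
  The potential of \<open>i\<close> is the maximal weight of a path starting at \<open>i\<close>. Prepending an edge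
  to a path either gives a path or closes a cycle, and cycles may be dropped.
\<close>

lemma potential_exists:
  fixes v :: "'a \<Rightarrow> 'a \<Rightarrow> int"
  assumes fin: "finite S"
    and loop: "\<And>i. i \<in> S \<Longrightarrow> v i i = 0"
    and cycle: "\<And>\<sigma>. \<sigma> permutes S \<Longrightarrow> (\<And>i. i \<in> S \<Longrightarrow> \<sigma> i = i \<or> E i (\<sigma> i)) \<Longrightarrow> (\<Sum>i\<in>S. v i (\<sigma> i)) \<le> 0"
  obtains u where "\<And>i j. i \<in> S \<Longrightarrow> j \<in> S \<Longrightarrow> E i j \<Longrightarrow> v i j \<le> u i - u j"
proof -
  define paths where
    "paths i = {p. set p \<subseteq> S \<and> distinct p \<and> p \<noteq> [] \<and> hd p = i \<and> successively E p}" for i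
  define u where "u i = Max (path_weight v ` paths i)" for i
  have finite_paths: "finite (paths i)" for i
    by (rule finite_subset[OF _ finite_subset_distinct[OF fin]]) (auto simp: paths_def)
  have le_u: "path_weight v p \<le> u i" if "p \<in> paths i" for p i
    using that finite_paths by (auto simp: u_def)
  have "v i j \<le> u i - u j" if ij: "i \<in> S" "j \<in> S" "E i j" for i j
  proof -
    have "[j] \<in> paths j"
      using ij by (simp add: paths_def)
    then have "u j \<in> path_weight v ` paths j"
      unfolding u_def using finite_paths by (intro Max_in) auto
    then obtain p where p: "p \<in> paths j" "u j = path_weight v p" by blast
    have "v i j + path_weight v p \<le> u i"
    proof (cases "i \<in> set p")
      case False
      with p ij have "i # p \<in> paths i"
        by (auto simp: paths_def successively_Cons)
      moreover from p have "p = j # tl p"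
        by (cases p) (auto simp: paths_def)
      then have "path_weight v (i # p) = v i j + path_weight v p"
        by (metis path_weight.simps(1))
      ultimately show ?thesis using le_u by metis
    next
      case True
      \<comment> \<open>The path from \<open>j\<close> passes through \<open>i\<close>. The edge
        from \<open>i\<close> to \<open>j\<close> and the part up to \<open>i\<close> form a cycle,
        of weight at most 0; the part from \<open>i\<close> on is a path, bounded by
        \<open>u i\<close>.\<close>
      then obtain q t where qt: "p = q @ i # t" by (meson split_list)
      have "i # t \<in> paths i"
        using p ij by (auto simp: paths_def qt successively_append_iff)
      then have t: "path_weight v (i # t) \<le> u i" by (rule le_u)
      have j: "q @ i # t = j # tl (q @ i # t)"
        using p by (cases "q @ i # t") (auto simp: paths_def qt)
      have dist: "distinct (i # q)" and sub: "set (i # q) \<subseteq> S"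
        using p by (auto simp: paths_def qt)
      have succ: "successively E (i # q @ [i])"
        using p ij by (cases q) (auto simp: paths_def qt successively_append_iff successively_Cons hd_append)
      have cl: "v i j + path_weight v (q @ [i]) = path_weight v (i # q @ [i])"
        using j by (cases q) auto
      let ?c = "cycle_of_list (i # q)"
      have perm: "?c permutes S"
        using cycle_permutes sub by (rule permutes_subset)
      \<comment> \<open>Vertices off the cycle are fixed and contribute \<open>v k k = 0\<close>, so
        the cycle extends to a permutation of \<open>S\<close> of the same weight.\<close>
      have "k \<notin> set (i # q) \<Longrightarrow> ?c k = k" for k
        by (rule id_outside_supp)
      then have "(\<Sum>k\<in>S. v k (?c k)) = (\<Sum>k\<in>set (i # q). v k (?c k))"
        using loop sub fin by (intro sum.mono_neutral_right) auto
      moreover have "(\<Sum>k\<in>S. v k (?c k)) \<le> 0"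
        using perm
      proof (rule cycle)
        fix k
        show "?c k = k \<or> E k (?c k)"
          using successively_cycle[OF dist succ, of k] id_outside_supp[of k "i # q"] by blast
      qed
      ultimately have "path_weight v (i # q @ [i]) \<le> 0"
        using path_weight_cycle[OF dist] by simp
      then show ?thesis
        using t cl path_weight_append[of v q i t] by (simp add: qt)
    qed
    then show ?thesis using p by simp
  qed
  then show ?thesis by (rule that)
qed

section \<open>Duality for the total order\<close>

lemma sum_op_order:
  "finite A \<Longrightarrow> (\<Sum>x\<in>A. op_order (f x))
    = (if \<exists>x\<in>A. f x = 0 then -\<infinity> else Fin (\<Sum>x\<in>A. int (op_degree (f x))))"
  by (induction A rule: finite_induct) (auto simp: op_order_eq zero_extended_def)

text \<open>A maximal permutation \<tau> relabels the columns so that it becomes the diagonal. Its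
  maximality against the compositions with \<sigma> is the cycle condition of
  \<open>potential_exists\<close> for the weights relative to the diagonal.\<close>

lemma total_order_dual:
  fixes M :: "'a::differential_field diff_op mat"
  assumes M: "M \<in> carrier_mat n n" and t: "total_order M = Fin t"
  shows "\<exists>N g. (\<forall>i<n. \<forall>j<n. M $$ (i, j) \<noteq> 0 \<longrightarrow> int (op_degree (M $$ (i, j))) \<le> N j + g i) \<and>
    sum N {..<n} + sum g {..<n} = t"
proof -
  let ?S = "{..<n}"
  define W where "W \<sigma> = (\<Sum>i<n. op_order (M $$ (i, \<sigma> i)))" for \<sigma>
  have dim: "dim_row M = n" using M by simp
  have fin: "finite {\<sigma>. \<sigma> permutes ?S}" by (rule finite_permutations) simp
  have tord: "total_order M = Max (W ` {\<sigma>. \<sigma> permutes ?S})"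
    by (simp add: total_order_def W_def dim)
  have W_le: "W \<sigma> \<le> Fin t" if "\<sigma> permutes ?S" for \<sigma>
    using fin that unfolding t[symmetric] tord by (intro Max_ge) auto
  have "Max (W ` {\<sigma>. \<sigma> permutes ?S}) \<in> W ` {\<sigma>. \<sigma> permutes ?S}"
    using fin permutes_id[of ?S] by (intro Max_in) blast+
  then obtain \<tau> where \<tau>: "\<tau> permutes ?S" "W \<tau> = Fin t"
    using t tord by auto
  have W: "W \<sigma> = (if \<exists>i<n. M $$ (i, \<sigma> i) = 0 then -\<infinity>
      else Fin (\<Sum>i<n. int (op_degree (M $$ (i, \<sigma> i)))))" for \<sigma>
    unfolding W_def by (subst sum_op_order) auto
  define w where "w i j = int (op_degree (M $$ (i, \<tau> j)))" for i j
  have diag: "M $$ (i, \<tau> i) \<noteq> 0" if "i < n" for i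
    using \<tau>(2) that by (auto simp: W split: if_splits)
  have t_eq: "t = (\<Sum>i<n. w i i)"
    using \<tau>(2) by (auto simp: W w_def split: if_splits)
  \<comment> \<open>Only nonzero entries are edges: the zero operator has \<open>op_degree\<close> 0
    but order minus infinity, and is to impose no bound.\<close>
  define E where "E i j \<longleftrightarrow> M $$ (i, \<tau> j) \<noteq> 0" for i j
  obtain u where u: "\<And>i j. i \<in> ?S \<Longrightarrow> j \<in> ?S \<Longrightarrow> E i j \<Longrightarrow> w i j - w j j \<le> u i - u j"
  proof (rule potential_exists[of ?S "\<lambda>i j. w i j - w j j" E])
    fix \<sigma> assume \<sigma>: "\<sigma> permutes ?S" "\<And>i. i \<in> ?S \<Longrightarrow> \<sigma> i = i \<or> E i (\<sigma> i)"
    have "M $$ (i, (\<tau> \<circ> \<sigma>) i) \<noteq> 0" if "i < n" for i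
      using \<sigma>(2)[of i] that diag by (auto simp: E_def)
    then have "W (\<tau> \<circ> \<sigma>) = Fin (\<Sum>i<n. w i (\<sigma> i))"
      by (auto simp: W w_def)
    moreover have "W (\<tau> \<circ> \<sigma>) \<le> Fin t"
      using \<sigma>(1) \<tau>(1) by (intro W_le permutes_compose)
    moreover have "(\<Sum>i<n. w (\<sigma> i) (\<sigma> i)) = (\<Sum>i<n. w i i)"
      using sum.permute[OF \<sigma>(1), of "\<lambda>i. w i i"] by simp
    ultimately show "(\<Sum>i<n. w i (\<sigma> i) - w (\<sigma> i) (\<sigma> i)) \<le> 0"
      by (simp add: sum_subtractf t_eq)
  qed auto
  define \<rho> where "\<rho> = inv_into UNIV \<tau>"
  have \<rho>: "\<rho> permutes ?S" "\<tau> (\<rho> j) = j" for j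
    using \<tau>(1) by (simp_all add: \<rho>_def permutes_inv permutes_inverses)
  \<comment> \<open>With this choice \<open>N j + u (\<rho> j)\<close> is the order of the entry of
    column \<open>j\<close> on the maximal permutation, so the bounds add up to
    \<open>t\<close>.\<close>
  define N where "N j = w (\<rho> j) (\<rho> j) - u (\<rho> j)" for j
  show ?thesis
  proof (rule exI[of _ N], rule exI[of _ u], intro conjI allI impI)
    fix i j assume ij: "i < n" "j < n" "M $$ (i, j) \<noteq> 0"
    have j: "\<tau> (\<rho> j) = j" "\<rho> j \<in> ?S"
      using \<rho> ij permutes_in_image[OF \<rho>(1), of j] by auto
    show "int (op_degree (M $$ (i, j))) \<le> N j + u i"
      using u[of i "\<rho> j"] ij j by (auto simp: E_def N_def w_def)
  next
    have "sum N ?S = (\<Sum>i<n. w i i - u i)"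
      unfolding N_def using sum.permute[OF \<rho>(1), of "\<lambda>i. w i i - u i"] by simp
    then show "sum N ?S + sum u ?S = t"
      by (simp add: sum_subtractf t_eq)
  qed
qed

section \<open>The top coefficient of the Dieudonne determinant\<close>

definition top_matrix ::
    "nat \<Rightarrow> (nat \<Rightarrow> nat) \<Rightarrow> (nat \<Rightarrow> nat) \<Rightarrow> 'a::differential_field diff_op mat \<Rightarrow> 'a mat" where
  "top_matrix n N g M = mat n n (\<lambda>(i, j). op_coeff (M $$ (i, j)) (N j + g i))"

lemma top_matrix_carrier [simp]: "top_matrix n N g M \<in> carrier_mat n n"
  by (simp add: top_matrix_def)

lemma sum_update_add:
  fixes g :: "nat \<Rightarrow> nat"
  assumes "j < n"
  shows "(\<Sum>i<n. (g(j := g j + p)) i) = (\<Sum>i<n. g i) + p"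
proof -
  have "(\<Sum>i<n. (g(j := g j + p)) i) = (\<Sum>i<n. g i + (if i = j then p else 0))"
    by (rule sum.cong) auto
  then show ?thesis using assms by (simp add: sum.distrib)
qed

lemma sum_Fin: "(\<Sum>x\<in>A. Fin (f x)) = Fin (\<Sum>x\<in>A. f x :: int)"
  by (induction A rule: infinite_finite_induct) (simp_all add: zero_extended_def)

context dieudonne_det
begin

text \<open>The coefficient of \<open>\<lambda>\<^sup>s\<close> in the determinant is \<open>c\<close>, and no higher power occurs.\<close>

definition det_top :: "'a diff_op mat \<Rightarrow> nat \<Rightarrow> 'a \<Rightarrow> bool" where
  "det_top A s c \<longleftrightarrow> det_deg A \<le> Fin (int s) \<and> c = (if det_deg A = Fin (int s) then det1 A else 0)"

definition row_col_bound :: "(nat \<Rightarrow> nat) \<Rightarrow> (nat \<Rightarrow> nat) \<Rightarrow> 'a diff_op mat \<Rightarrow> bool" where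
  "row_col_bound N g A \<longleftrightarrow>
     A \<in> carrier_mat n n \<and> (\<forall>i<n. \<forall>j<n. op_degree (A $$ (i, j)) \<le> N j + g i)"

text \<open>The invariant of the triangularisation. Since \<open>det1\<close> vanishes only at
  degree minus infinity, a singular top matrix means that the degree stays below the sum of the
  bounds.\<close>

definition det_top_matrix :: "(nat \<Rightarrow> nat) \<Rightarrow> (nat \<Rightarrow> nat) \<Rightarrow> 'a diff_op mat \<Rightarrow> bool" where
  "det_top_matrix N g A \<longleftrightarrow> det_top A (sum N {..<n} + sum g {..<n}) (det (top_matrix n N g A))"

lemma row_col_boundD:
  "row_col_bound N g A \<Longrightarrow> A \<in> carrier_mat n n"
  "row_col_bound N g A \<Longrightarrow> i < n \<Longrightarrow> j < n \<Longrightarrow> op_degree (A $$ (i, j)) \<le> N j + g i"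
  by (simp_all add: row_col_bound_def)

section \<open>Compatibility with row operations\<close>

lemma det_diag_monic:
  assumes "A \<in> carrier_mat n n" "upper_triangular A" "\<And>i. i < n \<Longrightarrow> op_lead_coeff (A $$ (i, i)) = 1"
  shows "det1 A = 1" and "det_deg A = Fin (\<Sum>i<n. int (op_degree (A $$ (i, i))))"
proof -
  show "det1 A = 1"
    using assms by (simp add: det1_upper_triangular)
  have "op_order (A $$ (i, i)) = Fin (int (op_degree (A $$ (i, i))))" if "i < n" for i
    using assms(3)[OF that] op_lead_coeff_eq_0_iff[of "A $$ (i, i)"] by (auto simp: op_order_eq)
  then show "det_deg A = Fin (\<Sum>i<n. int (op_degree (A $$ (i, i))))"
    using assms by (simp add: det_deg_upper_triangular sum_Fin)
qed

text \<open>Scaling a row is multiplication by a diagonal matrix, to which multiplicativity and the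
  triangular case apply.\<close>

lemma det_multrow_monic:
  assumes A: "A \<in> carrier_mat n n" and j: "j < n" and P: "op_lead_coeff P = 1"
  shows "det1 (multrow j P A) = det1 A"
    and "det_deg (multrow j P A) = Fin (int (op_degree P)) + det_deg A"
proof -
  let ?E = "multrow_mat n j P"
  have lead1: "op_lead_coeff 1 = (1 :: 'a)"
    by (simp add: op_lead_coeff_eq op_coeff_1)
  have E: "?E \<in> carrier_mat n n" "upper_triangular ?E"
    "op_lead_coeff (?E $$ (i, i)) = 1" if "i < n" for i
    using P that lead1 by (auto simp: multrow_mat_def)
  have "(\<Sum>i<n. int (op_degree (?E $$ (i, i)))) = (\<Sum>i<n. if i = j then int (op_degree P) else 0)"
    by (rule sum.cong) (auto simp: multrow_mat_def)
  then have "det1 ?E = 1" "det_deg ?E = Fin (int (op_degree P))"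
    using det_diag_monic[of ?E] E j by auto
  then show "det1 (multrow j P A) = det1 A"
    "det_deg (multrow j P A) = Fin (int (op_degree P)) + det_deg A"
    using A E j by (simp_all add: multrow_mat[OF A] det1_mult det_deg_mult)
qed

text \<open>The row bounds move with the rows, and both determinants change sign. The property
  passes back from the simplified matrix to the original one, as it does for the Ore step
  below.\<close>

lemma det_top_matrix_swap:
  assumes A: "A \<in> carrier_mat n n" and ij: "i < n" "j < n" "i \<noteq> j"
    and top: "det_top_matrix N (g \<circ> transpose i j) (swaprows i j A)"
  shows "det_top_matrix N g A"
proof -
  have "top_matrix n N (g \<circ> transpose i j) (swaprows i j A) = swaprows i j (top_matrix n N g A)"
    using A ij by (intro eq_matI) (auto simp: top_matrix_def transpose_def)
  then have "det (top_matrix n N (g \<circ> transpose i j) (swaprows i j A)) = - det (top_matrix n N g A)"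
    using ij by (simp add: det_swaprows[of _ n])
  moreover have "sum (g \<circ> transpose i j) {..<n} = sum g {..<n}"
    using ij by (intro sum.permute[symmetric] permutes_swap_id) auto
  ultimately show ?thesis
    using top A ij unfolding det_top_matrix_def det_top_def
    by (auto simp: det1_swaprows det_deg_swaprows simp del: of_nat_sum of_nat_add split: if_splits)
qed

lemma addrow_multrow_bound:
  assumes A: "row_col_bound N g A" and ij: "i < n" "j < n" "i \<noteq> j"
    and Q: "op_degree Q + g i \<le> g j + op_degree P"
  shows "row_col_bound N (g(j := g j + op_degree P)) (addrow (- Q) j i (multrow j P A))"
  unfolding row_col_bound_def
proof (intro conjI allI impI)
  note carr = row_col_boundD(1)[OF A] and deg = row_col_boundD(2)[OF A]
  show "addrow (- Q) j i (multrow j P A) \<in> carrier_mat n n"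
    using carr by simp
  fix k l assume kl: "k < n" "l < n"
  have "op_degree (- Q * A $$ (i, l)) \<le> op_degree Q + (N l + g i)"
    "op_degree (P * A $$ (j, l)) \<le> op_degree P + (N l + g j)"
    using deg ij kl by (auto intro: op_degree_mult_le)
  then have "op_degree (- Q * A $$ (i, l) + P * A $$ (j, l)) \<le> N l + (g j + op_degree P)"
    using Q by (intro op_degree_add_le) linarith+
  then show "op_degree (addrow (- Q) j i (multrow j P A) $$ (k, l))
      \<le> N l + (g(j := g j + op_degree P)) k"
    using carr deg ij kl by auto
qed

text \<open>On top coefficients the Ore step is an ordinary row operation, because \<open>P\<close>
  is monic. The degree and the sum of the bounds both grow by the order of \<open>P\<close>.\<close>

lemma det_top_matrix_addrow_multrow:
  assumes A: "row_col_bound N g A" and ij: "i < n" "j < n" "i \<noteq> j"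
    and P: "op_lead_coeff P = 1" and Q: "op_degree Q + g i \<le> g j + op_degree P"
    and top: "det_top_matrix N (g(j := g j + op_degree P)) (addrow (- Q) j i (multrow j P A))"
  shows "det_top_matrix N g A"
proof -
  note carr = row_col_boundD(1)[OF A] and deg = row_col_boundD(2)[OF A]
  define B where "B = addrow (- Q) j i (multrow j P A)"
  define g' where "g' = g(j := g j + op_degree P)"
  \<comment> \<open>The gap between the new bound of row \<open>j\<close> and the bound of row
    \<open>i\<close>. \<open>Q\<close> has order at most \<open>e\<close>, and its coefficient there
    may vanish.\<close>
  define e where "e = g j + op_degree P - g i"
  have e: "op_degree Q \<le> e" "g j + op_degree P = e + g i"
    using Q by (simp_all add: e_def)
  have "top_matrix n N g' B = addrow (- op_coeff Q e) j i (top_matrix n N g A)"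
  proof (intro eq_matI)
    fix k l assume "k < dim_row (addrow (- op_coeff Q e) j i (top_matrix n N g A))"
      "l < dim_col (addrow (- op_coeff Q e) j i (top_matrix n N g A))"
    then have kl: "k < n" "l < n" by (simp_all add: top_matrix_def)
    have "N l + (g j + op_degree P) = e + (N l + g i)"
      using e by simp
    then have "op_coeff (Q * A $$ (i, l)) (N l + (g j + op_degree P))
        = op_coeff Q e * op_coeff (A $$ (i, l)) (N l + g i)"
      using op_coeff_mult_top[OF e(1) deg[OF ij(1) kl(2)]] by metis
    moreover have "N l + (g j + op_degree P) = op_degree P + (N l + g j)"
      by simp
    then have "op_coeff (P * A $$ (j, l)) (N l + (g j + op_degree P))
        = op_coeff (A $$ (j, l)) (N l + g j)"
      using op_coeff_mult_top[OF le_refl deg[OF ij(2) kl(2)], of P] P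
      by (metis mult_1_left op_lead_coeff_eq)
    ultimately have "op_coeff (- Q * A $$ (i, l) + P * A $$ (j, l)) (N l + (g j + op_degree P))
        = - op_coeff Q e * op_coeff (A $$ (i, l)) (N l + g i) + op_coeff (A $$ (j, l)) (N l + g j)"
      by (simp add: op_coeff_diff)
    then show "top_matrix n N g' B $$ (k, l)
        = addrow (- op_coeff Q e) j i (top_matrix n N g A) $$ (k, l)"
      using carr ij kl by (auto simp: top_matrix_def B_def g'_def)
  qed (simp_all add: top_matrix_def)
  then have "det (top_matrix n N g' B) = det (top_matrix n N g A)"
    using ij by (simp add: det_addrow[of _ n])
  moreover have "sum g' {..<n} = sum g {..<n} + op_degree P"
    unfolding g'_def by (rule sum_update_add) (rule ij)
  moreover have "det1 B = det1 A" "det_deg B = Fin (int (op_degree P)) + det_deg A"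
    using carr ij P by (simp_all add: B_def det1_addrow det_deg_addrow det_multrow_monic)
  ultimately show ?thesis
    using top unfolding det_top_matrix_def det_top_def B_def[symmetric] g'_def[symmetric]
    by (cases "det_deg A") auto
qed

text \<open>Both determinants are products over the diagonal. They agree if every diagonal entry
  attains its bound; otherwise the degree is too small and the top matrix has a zero on its
  diagonal.\<close>

lemma det_top_matrix_upper_triangular:
  assumes A: "row_col_bound N g A" and ut: "upper_triangular A"
  shows "det_top_matrix N g A"
proof -
  note carr = row_col_boundD(1)[OF A] and deg = row_col_boundD(2)[OF A]
  let ?T = "top_matrix n N g A"
  have "upper_triangular ?T"
    using ut carr by (auto simp: top_matrix_def upper_triangular_def)
  then have detT: "det ?T = (\<Prod>i<n. op_coeff (A $$ (i, i)) (N i + g i))"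
    by (subst det_upper_triangular[of _ n])
      (simp_all add: prod_list_diag_prod top_matrix_def lessThan_atLeast0)
  have det1: "det1 A = (\<Prod>i<n. op_lead_coeff (A $$ (i, i)))"
    using carr ut by (rule det1_upper_triangular)
  show ?thesis
  proof (cases "\<exists>i<n. A $$ (i, i) = 0")
    case True
    then obtain i where i: "i < n" "A $$ (i, i) = 0" by blast
    then have "det1 A = 0" "det ?T = 0"
      unfolding det1 detT by (auto simp: op_lead_coeff_eq_0_iff intro!: prod_zero bexI[of _ i])
    moreover from this have "det_deg A = -\<infinity>"
      using carr det_deg_eq_minus_infinity_iff by blast
    ultimately show ?thesis by (simp add: det_top_matrix_def det_top_def)
  next
    case False
    let ?D = "\<lambda>i. op_degree (A $$ (i, i))"
    have d: "det_deg A = Fin (int (\<Sum>i<n. ?D i))"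
      using False carr ut by (simp add: det_deg_upper_triangular op_order_eq sum_Fin)
    have le: "?D i \<le> N i + g i" if "i < n" for i
      using deg that by simp
    have S: "sum N {..<n} + sum g {..<n} = (\<Sum>i<n. N i + g i)"
      by (simp add: sum.distrib)
    show ?thesis
    proof (cases "\<forall>i<n. ?D i = N i + g i")
      case True
      then have "det1 A = det ?T" "(\<Sum>i<n. ?D i) = (\<Sum>i<n. N i + g i)"
        unfolding det1 detT by (auto simp: op_lead_coeff_eq)
      then show ?thesis by (simp add: det_top_matrix_def det_top_def d S)
    next
      case False
      then obtain i where i: "i < n" "?D i < N i + g i"
        using le le_neq_implies_less by blast
      then have "det ?T = 0"
        unfolding detT by (auto simp: op_coeff_eq_0 intro!: prod_zero bexI[of _ i])
      moreover have "(\<Sum>i<n. ?D i) < (\<Sum>i<n. N i + g i)"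
        using le i by (intro sum_strict_mono_ex1) auto
      ultimately show ?thesis
        by (simp add: det_top_matrix_def det_top_def d S del: of_nat_sum of_nat_add)
    qed
  qed
qed

text \<open>
  Triangularisation by row operations \<open>row\<^sub>j := P row\<^sub>j - Q row\<^sub>i\<close> with \<open>P\<close> monic. Choosing the
  pivot row \<open>i\<close> with the larger value of degree minus row bound keeps \<open>Q\<close> small enough
  for the degree bounds to survive after raising the bound of row \<open>j\<close> by the order of \<open>P\<close>.
\<close>

lemma det_top_matrix_columns:
  assumes "c \<le> n" "row_col_bound N g A" "\<And>i k. i < n \<Longrightarrow> k < c \<Longrightarrow> k < i \<Longrightarrow> A $$ (i, k) = 0"
  shows "det_top_matrix N g A"
  using assms
proof (induction "n - c" arbitrary: c g A)
  case 0
  then have "upper_triangular A"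
    using row_col_boundD(1)[OF "0.prems"(2)] by (auto simp: upper_triangular_def)
  with 0 show ?case by (intro det_top_matrix_upper_triangular)
next
  case (Suc r)
  then have c: "c < n" by simp
  let ?nz = "\<lambda>A. {i. c \<le> i \<and> i < n \<and> A $$ (i, c) \<noteq> (0 :: 'a diff_op)}"
  have step: "det_top_matrix N g A"
    if "row_col_bound N g A" "\<And>i k. i < n \<Longrightarrow> k \<le> c \<Longrightarrow> k < i \<Longrightarrow> A $$ (i, k) = 0" for g A
  proof (rule Suc.hyps(1))
    show "r = n - Suc c" "Suc c \<le> n" using Suc.hyps(2) by auto
  qed (use that in auto)
  show ?case
    using Suc.prems(2,3)
  proof (induction "card (?nz A)" arbitrary: g A rule: less_induct)
    case less
    note carr = row_col_boundD(1)[OF less.prems(1)]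
    note cleared = less.prems(2)
    \<comment> \<open>The inner induction lowers the number of nonzero entries of column
      \<open>c\<close> in the rows from \<open>c\<close> on: two of them allow an Ore step, and a
      single one off the diagonal is swapped into place.\<close>
    consider (zero) "\<forall>i\<in>?nz A. i = c" | (one) i where "i \<noteq> c" "?nz A = {i}"
      | (two) i j where "i \<noteq> j" "i \<in> ?nz A" "j \<in> ?nz A"
          "op_degree (A $$ (j, c)) + g i \<le> op_degree (A $$ (i, c)) + g j"
    proof (cases "\<exists>i\<in>?nz A. \<exists>j\<in>?nz A. i \<noteq> j")
      case True
      then obtain i j where "i \<in> ?nz A" "j \<in> ?nz A" "i \<noteq> j" by blast
      then show ?thesis
        using two[of i j] two[of j i]
        by (cases "op_degree (A $$ (j, c)) + g i \<le> op_degree (A $$ (i, c)) + g j") simp_all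
    next
      case False
      then show ?thesis using zero one by (cases "\<forall>i\<in>?nz A. i = c") blast+
    qed
    then show ?case
    proof cases
      case zero
      then show ?thesis
        using cleared less.prems(1) by (intro step) (auto simp: le_less)
    next
      case one
      then have mem: "c \<le> k \<and> k < n \<and> A $$ (k, c) \<noteq> 0 \<longleftrightarrow> k = i" for k
        by (simp add: set_eq_iff)
      have i: "i < n" "c < i"
        using mem[of i] one(1) by simp_all
      have zero: "A $$ (k, c) = 0" if "c \<le> k" "k < n" "k \<noteq> i" for k
        using mem[of k] that by simp
      have "det_top_matrix N (g \<circ> transpose c i) (swaprows c i A)"
      proof (rule step)
        show "row_col_bound N (g \<circ> transpose c i) (swaprows c i A)"
          using less.prems(1) i c by (auto simp: row_col_bound_def transpose_def)
      next
        fix k l assume "k < n" "l \<le> c" "l < k"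
        then show "swaprows c i A $$ (k, l) = 0"
          using carr i c cleared zero[of k] zero[of c] by (auto simp: le_less)
      qed
      then show ?thesis using carr c i by (intro det_top_matrix_swap[of A c i]) auto
    next
      case two
      then have ij: "i < n" "j < n" "c \<le> i" "c \<le> j" "A $$ (i, c) \<noteq> 0" "A $$ (j, c) \<noteq> 0" by auto
      obtain P Q where PQ: "op_lead_coeff P = 1" "P * A $$ (j, c) = Q * A $$ (i, c)"
        using diff_op_ore_monic[OF ij(5)] .
      have "P \<noteq> 0" using PQ(1) op_lead_coeff_eq_0_iff[of P] by auto
      then have "P * A $$ (j, c) \<noteq> 0" using ij by (simp add: diff_op_mult_eq_0_iff)
      then have "Q \<noteq> 0" using PQ(2) by auto
      then have "op_degree P + op_degree (A $$ (j, c)) = op_degree Q + op_degree (A $$ (i, c))"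
        using op_degree_mult[OF \<open>P \<noteq> 0\<close> ij(6)] op_degree_mult[OF \<open>Q \<noteq> 0\<close> ij(5)] PQ(2) by simp
      \<comment> \<open>Both sides of the Ore relation have the same order, so the choice of the
        pivot bounds the order of \<open>Q\<close>.\<close>
      then have Q: "op_degree Q + g i \<le> g j + op_degree P" using two by linarith
      let ?B = "addrow (- Q) j i (multrow j P A)"
      have B: "?B $$ (k, l) = (if k = j then - Q * A $$ (i, l) + P * A $$ (j, l) else A $$ (k, l))"
        if "k < n" "l < n" for k l
        using carr ij that two by auto
      have "det_top_matrix N (g(j := g j + op_degree P)) ?B"
      proof (rule less.hyps)
        show "row_col_bound N (g(j := g j + op_degree P)) ?B"
          using less.prems(1) ij two Q by (intro addrow_multrow_bound) auto
      next
        fix k l assume kl: "k < n" "l < c" "l < k"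
        then have "A $$ (i, l) = 0" "A $$ (j, l) = 0" "A $$ (k, l) = 0" "l < n"
          using cleared ij c by auto
        then show "?B $$ (k, l) = 0" using B kl by simp
      next
        have "?nz ?B = ?nz A - {j}"
          using B c PQ(2) by (auto split: if_splits)
        moreover have "finite (?nz A)" "j \<in> ?nz A" using ij by auto
        ultimately show "card (?nz ?B) < card (?nz A)"
          by (simp only: card_Diff1_less)
      qed
      then show ?thesis
        using det_top_matrix_addrow_multrow[OF less.prems(1) ij(1,2) two(1) PQ(1) Q] by blast
    qed
  qed
qed

lemma det_top_matrix: "row_col_bound N g A \<Longrightarrow> det_top_matrix N g A"
  by (rule det_top_matrix_columns[of 0]) auto

end

section \<open>Degeneracy degree one\<close>

text \<open>Stated for a general ring, so that it applies to the polynomials with coefficients in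
  the differential subring.\<close>

lemma det_in_subring:
  fixes A :: "'a::comm_ring_1 mat"
  assumes S: "1 \<in> S" "\<And>a b. a \<in> S \<Longrightarrow> b \<in> S \<Longrightarrow> a + b \<in> S" "\<And>a. a \<in> S \<Longrightarrow> - a \<in> S"
      "\<And>a b. a \<in> S \<Longrightarrow> b \<in> S \<Longrightarrow> a * b \<in> S"
    and A: "A \<in> carrier_mat n n" "\<And>i j. i < n \<Longrightarrow> j < n \<Longrightarrow> A $$ (i, j) \<in> S"
  shows "det A \<in> S"
proof -
  have zero: "0 \<in> S" using S(2)[OF S(1) S(3)[OF S(1)]] by simp
  have sum: "sum f I \<in> S" if "\<And>x. x \<in> I \<Longrightarrow> f x \<in> S" for f :: "(nat \<Rightarrow> nat) \<Rightarrow> 'a" and I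
    using that by (induction I rule: infinite_finite_induct) (auto intro: S zero)
  have prod: "prod f I \<in> S" if "\<And>x. x \<in> I \<Longrightarrow> f x \<in> S" for f :: "nat \<Rightarrow> 'a" and I
    using that by (induction I rule: infinite_finite_induct) (auto intro: S)
  have sign: "signof \<sigma> \<in> S" for \<sigma> :: "nat \<Rightarrow> nat"
    using S by (auto simp: sign_def)
  show ?thesis
    unfolding det_def'[OF A(1)]
  proof (intro sum S(4) sign prod)
    fix \<sigma> i assume "\<sigma> \<in> {\<sigma>. \<sigma> permutes {0..<n}}" "i \<in> {0..<n}"
    then show "A $$ (i, \<sigma> i) \<in> S"
      using A(2) permutes_in_image[of \<sigma> "{0..<n}" i] by simp
  qed
qed

text \<open>Kept over a semiring, as it is applied to noncommutative operator entries and to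
  polynomials alike.\<close>

definition row_comb :: "nat \<Rightarrow> nat \<Rightarrow> (nat \<Rightarrow> 'a::semiring_1) \<Rightarrow> 'a mat" where
  "row_comb n i u = mat n n (\<lambda>(k, l). if k = i then u l else if k = l then 1 else 0)"

lemma row_comb_carrier [simp]: "row_comb n i u \<in> carrier_mat n n"
  by (simp add: row_comb_def)

lemma index_row_comb_mult:
  assumes "A \<in> carrier_mat n n" "k < n" "j < n"
  shows "(row_comb n i u * A) $$ (k, j) = (if k = i then \<Sum>l<n. u l * A $$ (l, j) else A $$ (k, j))"
proof (cases "k = i")
  case True
  then show ?thesis
    using assms by (simp add: row_comb_def scalar_prod_def lessThan_atLeast0)
next
  case False
  then have "row (row_comb n i u) k = unit_vec n k"
    using assms by (intro eq_vecI) (auto simp: row_comb_def)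
  then show ?thesis
    using assms False by (simp add: row_comb_def)
qed

text \<open>A permutation other than the identity moves some \<open>k\<close> different from
  \<open>i\<close>, where it meets a zero entry.\<close>

lemma det_row_comb:
  fixes u :: "nat \<Rightarrow> 'a::comm_ring_1"
  assumes i: "i < n"
  shows "det (row_comb n i u) = u i"
proof -
  let ?U = "row_comb n i u"
  have zero: "signof \<sigma> * (\<Prod>k = 0..<n. ?U $$ (k, \<sigma> k)) = 0"
    if \<sigma>: "\<sigma> permutes {0..<n}" "\<sigma> \<noteq> id" for \<sigma>
  proof -
    have "\<exists>k<n. k \<noteq> i \<and> \<sigma> k \<noteq> k"
    proof (rule ccontr)
      assume "\<not> ?thesis"
      then have fix_k: "\<sigma> k = k" if "k \<noteq> i" for k
        using that \<sigma>(1) by (cases "k < n") (auto simp: permutes_not_in)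
      moreover have "\<sigma> i = i"
        using fix_k permutes_inj[OF \<sigma>(1)] by (metis injD)
      ultimately show False using \<sigma>(2) by (metis eq_id_iff)
    qed
    then obtain k where k: "k < n" "k \<noteq> i" "\<sigma> k \<noteq> k" by blast
    moreover have "\<sigma> k < n"
      using permutes_in_image[OF \<sigma>(1), of k] k by simp
    ultimately have "?U $$ (k, \<sigma> k) = 0" by (simp add: row_comb_def)
    then have "(\<Prod>k = 0..<n. ?U $$ (k, \<sigma> k)) = 0"
      using k by (intro prod_zero) auto
    then show ?thesis by simp
  qed
  have "det ?U = (\<Sum>\<sigma>\<in>{id}. signof \<sigma> * (\<Prod>k = 0..<n. ?U $$ (k, \<sigma> k)))"
    unfolding det_def'[OF row_comb_carrier]
    using zero by (intro sum.mono_neutral_right) (auto simp: finite_permutations permutes_id)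
  also have "\<dots> = (\<Prod>k = 0..<n. ?U $$ (k, k))" by simp
  also have "\<dots> = (\<Prod>k = 0..<n. if k = i then u i else 1)"
    by (rule prod.cong) (auto simp: row_comb_def)
  finally show ?thesis using i by simp
qed

text \<open>
  Multiplying \<open>a + b X\<close> from the left by \<open>row_comb n i u\<close>, of determinant 1, makes row \<open>i\<close>
  divisible by \<open>X\<close>.
\<close>

lemma det_replace_row_eq_coeff:
  fixes a b :: "nat \<Rightarrow> nat \<Rightarrow> 'a::comm_ring_1"
  assumes i: "i < n" and u: "u i = 1" and null: "\<And>j. j < n \<Longrightarrow> (\<Sum>k<n. u k * a k j) = 0"
  shows "det (mat n n (\<lambda>(k, j). if k = i then \<Sum>l<n. u l * b l j else a k j))
    = coeff (det (mat n n (\<lambda>(k, j). [:a k j, b k j:]))) 1"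
proof -
  define A where "A = mat n n (\<lambda>(k, j). [:a k j, b k j:])"
  define U where "U = row_comb n i (\<lambda>k. [:u k:])"
  define C where "C = mat n n (\<lambda>(k, j). if k = i then [:\<Sum>l<n. u l * b l j:] else [:a k j, b k j:])"
  have carr: "A \<in> carrier_mat n n" "U \<in> carrier_mat n n" "C \<in> carrier_mat n n"
    by (simp_all add: A_def U_def C_def)
  have comb: "(\<Sum>l<n. [:u l:] * [:a l j, b l j:]) = [:\<Sum>l<n. u l * a l j, \<Sum>l<n. u l * b l j:]" for j
    by (rule poly_eqI) (simp add: coeff_sum coeff_pCons mult.commute split: nat.split)
  interpret eval_0: comm_ring_hom "\<lambda>p :: 'a poly. poly p 0"
    by unfold_locales simp_all
  have "U * A = multrow i [:0, 1:] C"
  proof (rule eq_matI)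
    fix k j assume "k < dim_row (multrow i [:0, 1:] C)" "j < dim_col (multrow i [:0, 1:] C)"
    then have kj: "k < n" "j < n" by (simp_all add: C_def)
    have "(U * A) $$ (k, j) = (if k = i then \<Sum>l<n. [:u l:] * A $$ (l, j) else A $$ (k, j))"
      unfolding U_def using carr(1) kj by (rule index_row_comb_mult)
    also have "(\<Sum>l<n. [:u l:] * A $$ (l, j)) = [:0, \<Sum>l<n. u l * b l j:]"
      using kj comb[of j] null by (simp add: A_def)
    finally show "(U * A) $$ (k, j) = multrow i [:0, 1:] C $$ (k, j)"
      using kj by (simp add: A_def C_def)
  qed (use carr in auto)
  moreover have "det U = 1"
    using i u by (simp add: U_def det_row_comb one_pCons)
  ultimately have "det A = [:0, 1:] * det C"
    using det_mult[OF carr(2,1)] det_multrow[OF i carr(3)] by simp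
  \<comment> \<open>The coefficient of X in \<open>[:0, 1:] * det C\<close> is the constant term of
    \<open>det C\<close>, which is the determinant of \<open>C\<close> evaluated at X = 0.\<close>
  then have "coeff (det A) 1 = poly (det C) 0"
    by (simp add: poly_0_coeff_0)
  also have "\<dots> = det (map_mat (\<lambda>p. poly p 0) C)"
    by (simp add: eval_0.hom_det)
  also have "map_mat (\<lambda>p. poly p 0) C
      = mat n n (\<lambda>(k, j). if k = i then \<Sum>l<n. u l * b l j else a k j)"
    by (rule eq_matI) (simp_all add: C_def)
  finally show ?thesis by (simp add: A_def)
qed

text \<open>The case of zero row bounds. Positivity of \<open>N\<close> keeps \<open>N j - 1\<close>
  from truncating. The right-hand side is free of the kernel vector, whose entries are quotients and
  may leave the subring.\<close>

lemma (in dieudonne_det) det1_of_degeneracy_1: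
  assumes A: "row_col_bound N (\<lambda>_. 0) A" and N: "\<And>j. j < n \<Longrightarrow> N j > 0"
    and deg: "det_deg A = Fin (int (sum N {..<n}) - 1)"
  shows "det1 A = coeff (det (mat n n (\<lambda>(i, j).
    [:op_coeff (A $$ (i, j)) (N j), op_coeff (A $$ (i, j)) (N j - 1):]))) 1"
proof -
  note carr = row_col_boundD(1)[OF A] and bound = row_col_boundD(2)[OF A, simplified]
  define a where "a i j = op_coeff (A $$ (i, j)) (N j)" for i j
  define b where "b i j = op_coeff (A $$ (i, j)) (N j - 1)" for i j
  define T where "T = top_matrix n N (\<lambda>_. 0) A"
  have T: "T \<in> carrier_mat n n" "\<And>i j. i < n \<Longrightarrow> j < n \<Longrightarrow> T $$ (i, j) = a i j"
    by (simp_all add: T_def top_matrix_def a_def)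
  \<comment> \<open>The degree is one below the sum of the bounds, so the coefficient at that sum
    vanishes.\<close>
  have "det T = 0"
    using det_top_matrix[OF A] deg by (simp add: det_top_matrix_def det_top_def T_def)
  then have "det T\<^sup>T = 0" using det_transpose[OF T(1)] by simp
  then obtain v where v: "v \<in> carrier_vec n" "v \<noteq> 0\<^sub>v n" "T\<^sup>T *\<^sub>v v = 0\<^sub>v n"
    using det_0_iff_vec_prod_zero_field[of "T\<^sup>T" n] T by auto
  then obtain i where i: "i < n" "v $ i \<noteq> 0"
    by (metis carrier_vecD eq_vecI index_zero_vec)
  define u where "u k = v $ k / v $ i" for k
  have u: "u i = 1" using i by (simp add: u_def)
  have null: "(\<Sum>k<n. u k * a k j) = 0" if "j < n" for j
  proof -
    have "0 = (T\<^sup>T *\<^sub>v v) $ j" using v that by simp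
    also have "\<dots> = (\<Sum>k<n. a k j * v $ k)"
      using v(1) T that by (simp add: scalar_prod_def lessThan_atLeast0)
    finally have "(\<Sum>k<n. v $ k * a k j) = 0" by (simp add: mult.commute)
    then show ?thesis by (simp add: u_def flip: sum_divide_distrib)
  qed
  define V where "V = row_comb n i (\<lambda>k. op_del * op_const (u k))"
  let ?g = "\<lambda>k. if k = i then 1 else 0 :: nat"
  have "op_degree (op_del * op_const (u j)) \<le> 1" for j
    using op_degree_mult_le[of op_del 1 "op_const (u j)" 0] by simp
  then have V: "row_col_bound (\<lambda>_. 0) ?g V"
    by (simp add: row_col_bound_def V_def row_comb_def)
  \<comment> \<open>\<open>V\<close> need not be triangular. With bound 1 for row \<open>i\<close>
    and 0 elsewhere its top matrix has determinant \<open>u i = 1\<close>, so its Dieudonne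
    determinant is \<lambda>.\<close>
  have "top_matrix n (\<lambda>_. 0) ?g V = row_comb n i u"
    by (rule eq_matI)
      (auto simp: top_matrix_def V_def row_comb_def op_coeff_del_mult op_coeff_const op_coeff_1)
  then have "det_top V 1 1"
    using det_top_matrix[OF V] i u by (simp add: det_top_matrix_def det_row_comb)
  then have detV: "det_deg V = Fin 1" "det1 V = 1"
    by (auto simp: det_top_def split: if_splits)
  define B where "B = V * A"
  have carrV: "V \<in> carrier_mat n n"
    by (simp add: V_def)
  then have carrB: "B \<in> carrier_mat n n"
    unfolding B_def using carr by (rule mult_carrier_mat)
  have detB: "det1 B = det1 A" "det_deg B = Fin (int (sum N {..<n}))"
    using carr carrV by (simp_all add: B_def det1_mult det_deg_mult detV deg)
  define q where "q j = (\<Sum>k<n. op_const (u k) * A $$ (k, j))" for j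
  have q: "op_coeff (q j) m = (\<Sum>k<n. u k * op_coeff (A $$ (k, j)) m)" for j m
    by (simp add: q_def op_coeff_sum op_coeff_const_mult)
  \<comment> \<open>Since \<open>u\<close> annihilates the top coefficients, \<open>q j\<close> has
    no terms from \<open>N j\<close> on, which leaves room for the factor
    \<open>op_del\<close>.\<close>
  have q_0: "op_coeff (q j) m = 0" if j: "j < n" and m: "N j \<le> m" for j m
  proof (cases "m = N j")
    case True
    then show ?thesis using null[OF j] by (simp add: q a_def)
  next
    case False
    then have "op_coeff (A $$ (k, j)) m = 0" if "k < n" for k
      using bound[OF that j] m by (intro op_coeff_eq_0) simp
    then show ?thesis by (simp add: q)
  qed
  have B: "B $$ (k, j) = (if k = i then op_del * q j else A $$ (k, j))" if "k < n" "j < n" for k j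
    using index_row_comb_mult[OF carr that] by (simp add: B_def V_def q_def sum_distrib_left mult.assoc)
  have "op_degree (op_del * q j) \<le> N j" if "j < n" for j
    using q_0[OF that] by (intro op_degree_leI) (auto simp: op_coeff_del_mult split: nat.split)
  then have "row_col_bound N (\<lambda>_. 0) B"
    using carrB B bound by (simp add: row_col_bound_def)
  from det_top_matrix[OF this] have "det1 A = det (top_matrix n N (\<lambda>_. 0) B)"
    by (simp add: det_top_matrix_def det_top_def detB del: of_nat_sum)
  also have "top_matrix n N (\<lambda>_. 0) B
      = mat n n (\<lambda>(k, j). if k = i then \<Sum>l<n. u l * b l j else a k j)"
  proof (rule eq_matI; clarsimp simp: top_matrix_def)
    fix k j assume kj: "k < n" "j < n"
    \<comment> \<open>At \<open>N j\<close> the derivative term vanishes, and the shift by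
      \<open>op_del\<close> brings up the coefficient of \<open>q j\<close> at
      \<open>N j - 1\<close>.\<close>
    have "op_coeff (op_del * q j) (N j) = (\<Sum>l<n. u l * b l j)"
      using N[OF kj(2)] q_0[OF kj(2)] by (auto simp: op_coeff_del_mult q b_def split: nat.split)
    then show "(k = i \<longrightarrow> op_coeff (B $$ (i, j)) (N j) = (\<Sum>l<n. u l * b l j)) \<and>
        (k \<noteq> i \<longrightarrow> op_coeff (B $$ (k, j)) (N j) = a k j)"
      using B kj by (auto simp: a_def)
  qed
  also have "det \<dots> = coeff (det (mat n n (\<lambda>(k, j). [:a k j, b k j:]))) 1"
    using i(1) u null by (rule det_replace_row_eq_coeff)
  finally show ?thesis by (simp only: a_def b_def)
qed

theorem proposition1p1:
  fixes R :: "'a::differential_field set"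
    and n :: nat
    and M :: "'a diff_op mat"
    and det1 :: "'a diff_op mat \<Rightarrow> 'a"
    and d :: "'a diff_op mat \<Rightarrow> int extended"
  assumes "differential_subring R"
    and "n \<ge> 1"
    and "M \<in> carrier_mat n n"
    and "\<And>i j. i < n \<Longrightarrow> j < n \<Longrightarrow> M $$ (i, j) \<in> diff_ops_over R"
    and "dieudonne_det n det1 d"
    and "degeneracy_degree d M = 1"
  shows "det1 M \<in> R"
proof -
  note R = differential_subringD[OF assms(1)] and carr = assms(3)
  interpret dieudonne_det n det1 d by (rule assms(5))
  \<comment> \<open>Once the degree is not infinity, a difference of 1 forces both values to be
    finite.\<close>
  have "\<exists>e. y = Fin e \<and> x = Fin (e + 1)" if "x - y = 1" "y \<noteq> \<infinity>" for x y :: "int extended"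
    using that by (cases x; cases y) (simp_all add: one_extended_def)
  from this[OF assms(6)[unfolded degeneracy_degree_def] det_deg_not_infinity[OF carr]]
  obtain e where e: "d M = Fin e" "total_order M = Fin (e + 1)" by blast
  from total_order_dual[OF carr e(2)] obtain N g
    where "\<forall>i<n. \<forall>j<n. M $$ (i, j) \<noteq> 0 \<longrightarrow> int (op_degree (M $$ (i, j))) \<le> N j + g i"
      and sum_gN: "sum N {..<n} + sum g {..<n} = e + 1"
    by (elim exE conjE)
  then have gN: "int (op_degree (M $$ (i, j))) \<le> N j + g i"
    if "i < n" "j < n" "M $$ (i, j) \<noteq> 0" for i j
    using that by simp
  \<comment> \<open>Multiplying row \<open>i\<close> by \<open>op_del ^ (C - g i)\<close> turns the bounds into natural numbers that
    depend on the column only.\<close>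
  define C where "C = 1 + (\<Sum>i<n. \<bar>g i\<bar>) + (\<Sum>j<n. \<bar>N j\<bar>)"
  have C: "g i < C" "- N i < C" if "i < n" for i
  proof -
    have "\<bar>g i\<bar> \<le> (\<Sum>i<n. \<bar>g i\<bar>)" "\<bar>N i\<bar> \<le> (\<Sum>i<n. \<bar>N i\<bar>)"
      using that by (intro member_le_sum; simp)+
    moreover have "0 \<le> (\<Sum>i<n. \<bar>g i\<bar>)" "0 \<le> (\<Sum>i<n. \<bar>N i\<bar>)"
      by (simp_all add: sum_nonneg)
    ultimately show "g i < C" "- N i < C" unfolding C_def by linarith+
  qed
  define c where "c i = nat (C - g i)" for i
  define N' where "N' j = nat (N j + C)" for j
  have c: "int (c i) = C - g i" and N': "int (N' i) = N i + C" "N' i > 0" if "i < n" for i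
    using C[OF that] by (simp_all add: c_def N'_def)
  define D where "D = mat n n (\<lambda>(i, j). if i = j then op_del ^ c i else (0 :: 'a diff_op))"
  define A where "A = D * M"
  have D: "D \<in> carrier_mat n n" "upper_triangular D"
    by (auto simp: D_def)
  have "det1 D = 1" "d D = Fin (\<Sum>i<n. int (op_degree (D $$ (i, i))))"
    using det_diag_monic[OF D] by (simp_all add: D_def)
  moreover have "(\<Sum>i<n. int (op_degree (D $$ (i, i)))) = (\<Sum>i<n. int (c i))"
    by (rule sum.cong) (simp_all add: D_def)
  ultimately have detA: "det1 A = det1 M" "d A = Fin ((\<Sum>i<n. int (c i)) + e)"
    using D(1) carr by (simp_all add: A_def det1_mult det_deg_mult e)
  have A: "A $$ (i, j) = op_del ^ c i * M $$ (i, j)" if "i < n" "j < n" for i j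
  proof -
    have "A $$ (i, j) = (\<Sum>k\<in>{0..<n}. D $$ (i, k) * M $$ (k, j))"
      using that D(1) carr by (simp add: A_def scalar_prod_def)
    also have "\<dots> = (\<Sum>k\<in>{i}. D $$ (i, k) * M $$ (k, j))"
      using that by (intro sum.mono_neutral_right) (auto simp: D_def)
    finally show ?thesis using that by (simp add: D_def)
  qed
  have "row_col_bound N' (\<lambda>_. 0) A"
    unfolding row_col_bound_def
  proof (intro conjI allI impI)
    show "A \<in> carrier_mat n n" using D(1) carr by (simp add: A_def)
    fix i j assume ij: "i < n" "j < n"
    show "op_degree (A $$ (i, j)) \<le> N' j + 0"
    proof (cases "M $$ (i, j) = 0")
      case False
      then have "int (c i + op_degree (M $$ (i, j))) \<le> int (N' j)"
        using gN[OF ij] c[OF ij(1)] N'(1)[OF ij(2)] by simp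
      then show ?thesis
        using op_degree_mult_le[of "op_del ^ c i" "c i" "M $$ (i, j)"] A[OF ij] by force
    qed (simp add: A[OF ij])
  qed
  \<comment> \<open>Scaling raises the degree and the total of the bounds alike by the sum of the
    \<open>c i\<close>, so the gap of 1 persists.\<close>
  moreover have "d A = Fin (int (sum N' {..<n}) - 1)"
    using sum_gN by (simp add: detA c N' sum_subtractf sum.distrib)
  ultimately have det: "det1 M = coeff (det (mat n n (\<lambda>(i, j).
      [:op_coeff (A $$ (i, j)) (N' j), op_coeff (A $$ (i, j)) (N' j - 1):]))) 1"
    using det1_of_degeneracy_1[of N' A] N'(2) detA(1) by simp
  have A_R: "op_coeff (A $$ (i, j)) k \<in> R" if "i < n" "j < n" for i j k
    using diff_ops_over_del_power[OF assms(1) assms(4)[OF that]] by (simp add: A[OF that] diff_ops_over_def)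
  have sum_R: "sum f I \<in> R" if "\<And>x. x \<in> I \<Longrightarrow> f x \<in> R" for f :: "nat \<Rightarrow> 'a" and I
    using that by (induction I rule: infinite_finite_induct) (auto intro: R)
  \<comment> \<open>The polynomials with coefficients in \<open>R\<close> form a ring containing all
    entries, so every coefficient of the determinant lies in \<open>R\<close>.\<close>
  have "det (mat n n (\<lambda>(i, j). [:op_coeff (A $$ (i, j)) (N' j), op_coeff (A $$ (i, j)) (N' j - 1):]))
      \<in> {p. \<forall>k. coeff p k \<in> R}"
  proof (rule det_in_subring[of _ _ n])
    show "1 \<in> {p. \<forall>k. coeff p k \<in> R}"
      using R(1,2) by (simp add: coeff_1)
  next
    fix p q assume "p \<in> {p. \<forall>k. coeff p k \<in> R}" "q \<in> {p. \<forall>k. coeff p k \<in> R}"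
    then show "p * q \<in> {p. \<forall>k. coeff p k \<in> R}"
      by (auto simp: coeff_mult intro!: sum_R R(5))
  qed (use R A_R in \<open>auto simp: coeff_pCons split: nat.split\<close>)
  then show ?thesis by (simp add: det)
qed

end
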